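(* Fix an integer $k\ge 2$ and let $q$ be a formal variable. For $i=1,\dots,k$ let $$G_i=\prod_{\substack{n\ge 1\\ n\not\equiv 0,\,\pm(k+1-i)\ (\mathrm{mod}\ 2k+1)}}\frac{1}{1-q^n},$$ and for $j\ge 1$ and $i=2,\dots,k$ define recursively (in the field $\mathbb{C}((q))$ of formal Laurent series) $$G_{(k-1)j+i}=\frac{G_{(k-1)(j-1)+k-i+1}-G_{(k-1)(j-1)+k-i+2}}{q^{(i-1)j}}.$$ For $j\ge 0$ and $i=1,\dots,k$ let $$H_{(k-1)j+i}=\frac{\sum_{\lambda\ge 0}(-1)^\lambda q^{(2k+1)\binom{\lambda}{2}+[k(j+1)+i]\lambda}(1-q^{\lambda+1})\cdots(1-q^{\lambda+j})\,(1-q^{(k-i+1)(2\lambda+j+1)})}{\prod_{n\ge 1}(1-q^n)}$$ (for $j=0$ the product $(1-q^{\lambda+1})\cdots(1-q^{\lambda+j})$ is empty, i.e. equal to $1$). Then for all $j\ge 0$ and $i=1,\dots,k$, $G_{(k-1)j+i}\in\mathbb{C}[[q]]$ and $G_{(k-1)j+i}=H_{(k-1)j+i}$. In particular, for each $j\ge 1$, $H_{(k-1)j+1}=H_{(k-1)(j-1)+k}$.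
   Context: Here $H_{(k-1)j+i}$ is regarded as a function of the pair $(j,i)$ (with $j\ge0$, $1\le i\le k$), so that the last equality compares the two expressions given by the pairs $(j,1)$ and $(j-1,k)$, both of which correspond to the same index $(k-1)j+1$. Note that $(k-1)(j-1)+k=(k-1)j+1$, so the recursion defines $G_s$ for every $s\ge 1$. *)

theory Defs
  imports
    "HOL-Analysis.Infinite_Products"
    "HOL-Number_Theory.Cong"
    "HOL-Computational_Algebra.Formal_Laurent_Series"
begin

text \<open>
  The formal variable \<open>q\<close> is \<^term>\<open>fps_X :: complex fps\<close> in the power series ring and
  \<^term>\<open>fls_X :: complex fls\<close> in the field of formal Laurent series; the former ring is embedded in
  the latter by \<^const>\<open>fps_to_fls\<close>. Infinite sums and products of power series are taken
  with respect to the library metric on \<^typ>\<open>complex fps\<close>, whose topology is the \<open>q\<close>-adic one.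
\<close>

text \<open>
  The products over \<open>n \<ge> 1\<close> are written with the index shifted by one, and the factors
  excluded by the congruence condition are replaced by \<open>1\<close>.
\<close>

definition G_prod :: "nat \<Rightarrow> nat \<Rightarrow> complex fps" where
  "G_prod k i = prodinf (\<lambda>m. let n = Suc m in
     if [int n = 0] (mod 2 * int k + 1) \<or>
        [int n = int k + 1 - int i] (mod 2 * int k + 1) \<or>
        [int n = - (int k + 1 - int i)] (mod 2 * int k + 1)
     then 1 else 1 / (1 - fps_X ^ n))"

text \<open>
  For \<open>k \<ge> 2\<close>, every \<open>s > k\<close> is \<open>(k - 1) * j + i\<close> for exactly one pair with \<open>j \<ge> 1\<close> and
  \<open>2 \<le> i \<le> k\<close>, computed by the \<open>let\<close> below. The recursion in terms of \<open>(j, i)\<close>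
  is the lemma \<open>G_rec\<close>. The values for \<open>k < 2\<close> and for \<open>s = 0\<close> are irrelevant.
\<close>

function G :: "nat \<Rightarrow> nat \<Rightarrow> complex fls" where
  "G k s =
    (if k < 2 \<or> s = 0 then 0
     else if s \<le> k then fps_to_fls (G_prod k s)
     else let j = (s - 2) div (k - 1); i = (s - 2) mod (k - 1) + 2 in
       (G k ((k - 1) * (j - 1) + k - i + 1) - G k ((k - 1) * (j - 1) + k - i + 2))
         / fls_X ^ ((i - 1) * j))"
  by pat_completeness auto

lemma G_index:
  fixes k s :: nat
  assumes "\<not> (k < 2 \<or> s = 0)" "\<not> s \<le> k"
  defines "j \<equiv> (s - 2) div (k - 1)" and "i \<equiv> (s - 2) mod (k - 1) + 2"
  shows "s = (k - 1) * j + i" "1 \<le> j" "2 \<le> i" "i \<le> k"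
    "(k - 1) * (j - 1) + k - i + 2 < s"
proof -
  have k: "k - 1 > 0" using assms by simp
  have "(k - 1) * j + (s - 2) mod (k - 1) = s - 2"
    unfolding j_def by (rule mult_div_mod_eq)
  then show s: "s = (k - 1) * j + i"
    using assms(1,2) unfolding i_def by linarith
  have "(k - 1) div (k - 1) \<le> (s - 2) div (k - 1)"
    using assms(1,2) by (intro div_le_mono) simp
  then show j: "1 \<le> j" using k by (simp add: j_def)
  show i2: "2 \<le> i" by (simp add: i_def)
  have "(s - 2) mod (k - 1) < k - 1" using k by simp
  then show ik: "i \<le> k" unfolding i_def by linarith
  from j obtain t where t: "j = Suc t" by (cases j) auto
  show "(k - 1) * (j - 1) + k - i + 2 < s"
    using s i2 ik assms(1) by (simp add: t)
qed

termination G
proof (relation "measure snd", goal_cases)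
  case 1
  show ?case by simp
next
  case (2 k s j i)
  then show ?case using G_index(5)[of k s] by simp
next
  case (3 k s j i)
  then show ?case using G_index(5)[of k s] by simp
qed

declare G.simps [simp del]

lemma G_init:
  assumes "2 \<le> k" "1 \<le> i" "i \<le> k"
  shows "G k i = fps_to_fls (G_prod k i)"
  using assms by (subst G.simps) simp

lemma G_rec:
  assumes "2 \<le> k" "1 \<le> j" "2 \<le> i" "i \<le> k"
  shows "G k ((k - 1) * j + i) =
    (G k ((k - 1) * (j - 1) + k - i + 1) - G k ((k - 1) * (j - 1) + k - i + 2))
      / fls_X ^ ((i - 1) * j)"
proof -
  have eq: "(k - 1) * j + i - 2 = (i - 2) + (k - 1) * j" using assms by simp
  have "i - 2 < k - 1" using assms by linarith
  then have d: "((k - 1) * j + i - 2) div (k - 1) = j"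
    and "((k - 1) * j + i - 2) mod (k - 1) = i - 2"
    unfolding eq by (simp_all del: One_nat_def)
  then have m: "((k - 1) * j + i - 2) mod (k - 1) + 2 = i"
    using assms(3) by simp
  have "(k - 1) * 1 \<le> (k - 1) * j" using assms(2) by (rule mult_le_mono2)
  then have "\<not> (k - 1) * j + i \<le> k" using assms by linarith
  then show ?thesis
    using assms(1,3) by (subst G.simps) (unfold d m Let_def, simp)
qed

text \<open>
  \<open>H k j i\<close> is \<open>H_{(k-1)j+i}\<close> as a function of the pair \<open>(j, i)\<close>.
\<close>

definition H :: "nat \<Rightarrow> nat \<Rightarrow> nat \<Rightarrow> complex fps" where
  "H k j i =
    (\<Sum>l. (-1) ^ l * fps_X ^ ((2 * k + 1) * (l choose 2) + (k * (j + 1) + i) * l)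
        * (\<Prod>m = 1..j. 1 - fps_X ^ (l + m))
        * (1 - fps_X ^ ((k - i + 1) * (2 * l + j + 1))))
    / prodinf (\<lambda>n. 1 - fps_X ^ Suc n)"

end

(*
  Multiply everything by prod (1 - q^n). The initial products are then given by the Jacobi triple
  product identity, which follows from its finite form (the q-binomial theorem) modulo every power
  of q. With a + c = k + 1 and N(j; a, c) the numerator of H_{(k-1)j+a}, the difference
  N(j; c, a) - N(j; c+1, a-1) becomes q^((a-1)(j+1)) N(j+1; a, c) after each summand is split in two
  and one of the halves is shifted by one index. This is the recursion of the G_s for a >= 2, and
  for a = 1 it is the equality of the two expressions for H_{(k-1)(j+1)+1}.
*)
theory Submission
  imports Defs
begin

section \<open>Congruence of power series modulo a power of the variable\<close>

text \<open>Limits are handled in \<open>fps_cong_suminf\<close> and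
  \<open>fps_cong_prodinf\<close>; afterwards identities are checked on finite truncations modulo
  every power of the variable.\<close>

definition fps_cong :: "nat \<Rightarrow> 'a fps \<Rightarrow> 'a fps \<Rightarrow> bool" where
  "fps_cong N f g \<longleftrightarrow> (\<forall>n<N. f $ n = g $ n)"

lemma fps_cong_refl [simp]: "fps_cong N f f"
  by (simp add: fps_cong_def)

lemma fps_cong_sym: "fps_cong N f g \<Longrightarrow> fps_cong N g f"
  by (simp add: fps_cong_def)

lemma fps_cong_trans [trans]: "fps_cong N f g \<Longrightarrow> fps_cong N g h \<Longrightarrow> fps_cong N f h"
  by (simp add: fps_cong_def)

lemma fps_cong_mono: "fps_cong N f g \<Longrightarrow> M \<le> N \<Longrightarrow> fps_cong M f g"
  by (simp add: fps_cong_def)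

lemma fps_cong_imp_eq: "(\<And>N. fps_cong N f g) \<Longrightarrow> f = g"
  unfolding fps_cong_def fps_eq_iff by blast

lemma fps_cong_add:
  "fps_cong N f g \<Longrightarrow> fps_cong N f' g' \<Longrightarrow> fps_cong N (f + f') (g + g')"
  by (simp add: fps_cong_def)

lemma fps_cong_diff:
  fixes f :: "'a::group_add fps"
  shows "fps_cong N f g \<Longrightarrow> fps_cong N f' g' \<Longrightarrow> fps_cong N (f - f') (g - g')"
  by (simp add: fps_cong_def)

lemma fps_cong_mult:
  "fps_cong N f g \<Longrightarrow> fps_cong N f' g' \<Longrightarrow> fps_cong N (f * f') (g * g')"
  by (auto simp: fps_cong_def fps_mult_nth intro!: sum.cong)

lemma fps_cong_sum:
  "(\<And>i. i \<in> A \<Longrightarrow> fps_cong N (f i) (g i)) \<Longrightarrow> fps_cong N (sum f A) (sum g A)"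
  by (simp add: fps_cong_def fps_sum_nth)

lemma fps_cong_prod:
  fixes f :: "'b \<Rightarrow> 'a::comm_ring_1 fps"
  shows "(\<And>i. i \<in> A \<Longrightarrow> fps_cong N (f i) (g i)) \<Longrightarrow> fps_cong N (prod f A) (prod g A)"
  by (induction A rule: infinite_finite_induct) (auto intro: fps_cong_mult)

lemma fps_cong_X_power_mult_0:
  fixes f :: "'a::comm_ring_1 fps"
  shows "N \<le> n \<Longrightarrow> fps_cong N (fps_X ^ n * f) 0"
  by (simp add: fps_cong_def fps_X_power_mult_nth)

lemma fps_cong_X_power_mult:
  fixes f :: "'a::comm_ring_1 fps"
  shows "fps_cong N f g \<Longrightarrow> fps_cong (n + N) (fps_X ^ n * f) (fps_X ^ n * g)"
  by (simp add: fps_cong_def fps_X_power_mult_nth)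

lemma fps_cong_1_minus_X_power:
  fixes f :: "'a::comm_ring_1 fps"
  shows "N \<le> n \<Longrightarrow> fps_cong N (1 - fps_X ^ n) (1 :: 'a fps)"
  using fps_cong_diff[OF fps_cong_refl fps_cong_X_power_mult_0, of N n 1 1] by simp

text \<open>Transfers a congruence from \<open>1 - fps_X ^ n\<close> to its inverse without
  expanding a geometric series.\<close>

lemma fps_cong_1_right_factor:
  fixes f :: "'a::comm_ring_1 fps"
  assumes "fps_cong N f 1" "fps_cong N (f * g) 1"
  shows "fps_cong N g 1"
proof -
  have "fps_cong N (1 * g) (f * g)"
    by (rule fps_cong_mult[OF fps_cong_sym[OF assms(1)] fps_cong_refl])
  then show ?thesis using assms(2) by (metis fps_cong_trans mult_1)
qed

section \<open>Truncation of infinite sums and products\<close>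

text \<open>Summand \<open>l\<close> is divisible by \<open>fps_X ^ l\<close>, so coefficient
  \<open>n\<close> of the partial sums is stationary once more than \<open>n\<close> summands are
  taken. The stationary values form the limit \<open>F\<close>.\<close>

lemma fps_cong_suminf:
  fixes f :: "nat \<Rightarrow> 'a::comm_ring_1 fps"
  assumes f: "\<And>l. fps_cong l (f l) 0"
  shows "fps_cong N (suminf f) (\<Sum>l<N. f l)"
proof -
  define F where "F = Abs_fps (\<lambda>n. (\<Sum>l<Suc n. f l) $ n)"
  have eq: "(\<Sum>l<L. f l) $ n = F $ n" if "L > n" for L n
  proof -
    have "(\<Sum>l<L. f l $ n) = (\<Sum>l<Suc n. f l $ n)"
      using f that by (intro sum.mono_neutral_right) (auto simp: fps_cong_def)
    then show ?thesis unfolding F_def by (simp only: fps_sum_nth fps_nth_Abs_fps)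
  qed
  have "(\<lambda>L. \<Sum>l<L. f l) \<longlonglongrightarrow> F"
  proof (rule tendsto_fpsI)
    fix n
    show "\<forall>\<^sub>F L in sequentially. (\<Sum>l<L. f l) $ n = F $ n"
      using eventually_gt_at_top[of n]
      by eventually_elim (rule eq)
  qed
  then have "suminf f = F" by (metis sums_def sums_unique)
  then show ?thesis
    by (simp add: fps_cong_def eq)
qed

text \<open>Factor \<open>m\<close> changes no coefficient of index at most \<open>m\<close>, so the
  partial products stabilise coefficientwise. The bound \<open>L\<close> may exceed
  \<open>N\<close>, so that a product can later be cut after whole blocks of factors.\<close>

lemma fps_cong_prodinf:
  fixes f :: "nat \<Rightarrow> 'a::idom fps"
  assumes f: "\<And>m. fps_cong (Suc m) (f m) 1"
  assumes "N \<le> L"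
  shows "fps_cong N (prodinf f) (\<Prod>m<L. f m)"
proof -
  have cong: "fps_cong n (\<Prod>m<L. f m) (\<Prod>m<n. f m)" if "n \<le> L" for L n
  proof -
    have "fps_cong n (\<Prod>m\<in>{n..<L}. f m) (\<Prod>m\<in>{n..<L}. 1)"
      by (rule fps_cong_prod) (auto intro: fps_cong_mono[OF f])
    then have "fps_cong n ((\<Prod>m<n. f m) * (\<Prod>m\<in>{n..<L}. f m)) ((\<Prod>m<n. f m) * 1)"
      by (intro fps_cong_mult) auto
    moreover have "(\<Prod>m<n. f m) * (\<Prod>m\<in>{n..<L}. f m) = (\<Prod>m<L. f m)"
      using that by (simp add: prod.atLeastLessThan_concat lessThan_atLeast0)
    ultimately show ?thesis by simp
  qed
  define F where "F = Abs_fps (\<lambda>n. (\<Prod>m<Suc n. f m) $ n)"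
  have eq: "(\<Prod>m<L. f m) $ n = F $ n" if "L > n" for L n
    using cong[of "Suc n" L] that
    unfolding F_def fps_nth_Abs_fps fps_cong_def by (meson Suc_leI lessI)
  have "(\<lambda>L. \<Prod>m\<le>L. f m) \<longlonglongrightarrow> F"
  proof (rule tendsto_fpsI)
    fix n
    show "\<forall>\<^sub>F L in sequentially. (\<Prod>m\<le>L. f m) $ n = F $ n"
      using eventually_ge_at_top[of n]
      by eventually_elim (simp only: flip: lessThan_Suc_atMost, rule eq, simp)
  qed
  \<comment> \<open>Convergence in the sense of \<open>has_prod\<close>, with no initial factors
    dropped, requires a nonzero limit.\<close>
  moreover have "F $ 0 = 1"
    using f[of 0] by (simp add: F_def fps_cong_def)
  then have "F \<noteq> 0" by auto
  ultimately have "f has_prod F"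
    by (simp add: has_prod_def raw_has_prod_def)
  then have "prodinf f = F" by (metis has_prod_unique)
  then show ?thesis
    using \<open>N \<le> L\<close> by (simp add: fps_cong_def eq)
qed

section \<open>Gaussian binomial coefficients and the finite triple product\<close>

text \<open>The q-Pochhammer symbol (Q; Q)_n, without the division by \<open>(1 - Q) ^ n\<close> of
  the usual q-factorial.\<close>

definition qfact :: "'a::comm_ring_1 \<Rightarrow> nat \<Rightarrow> 'a" where
  "qfact Q n = (\<Prod>m<n. 1 - Q ^ Suc m)"

text \<open>The q-Pascal rule serves as definition since it involves no division. Truncation in
  \<open>n - k\<close> is harmless: for \<open>n < k\<close> the factor \<open>qbinom Q n k\<close>
  is 0.\<close>

fun qbinom :: "'a::comm_ring_1 \<Rightarrow> nat \<Rightarrow> nat \<Rightarrow> 'a" where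
  "qbinom Q n 0 = 1"
| "qbinom Q 0 (Suc k) = 0"
| "qbinom Q (Suc n) (Suc k) = qbinom Q n (Suc k) + Q ^ (n - k) * qbinom Q n k"

lemma qbinom_eq_0: "n < k \<Longrightarrow> qbinom Q n k = 0"
  by (induction Q n k rule: qbinom.induct) auto

text \<open>The quotient formula, cleared of denominators. The two q-Pascal terms contribute
  \<open>1 - Q ^ (n - i)\<close> and \<open>Q ^ (n - i) * (1 - Q ^ Suc i)\<close> times
  \<open>qfact Q n\<close>, and these add up to \<open>1 - Q ^ Suc n\<close> times
  \<open>qfact Q n\<close>.\<close>

lemma qbinom_qfact: "k \<le> n \<Longrightarrow> qbinom Q n k * qfact Q k * qfact Q (n - k) = qfact Q n"
proof (induction n arbitrary: k)
  case 0
  then show ?case by (simp add: qfact_def)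
next
  case (Suc n)
  show ?case
  proof (cases k)
    case 0
    then show ?thesis by (simp add: qfact_def)
  next
    case (Suc i)
    with Suc.prems have "i \<le> n" by simp
    have first: "qbinom Q n (Suc i) * qfact Q (Suc i) * qfact Q (n - i) = qfact Q n * (1 - Q ^ (n - i))"
    proof (cases "i = n")
      case True
      then show ?thesis by (simp add: qbinom_eq_0)
    next
      case False
      with \<open>i \<le> n\<close> have "n - i = Suc (n - Suc i)" by simp
      then have "qfact Q (n - i) = qfact Q (n - Suc i) * (1 - Q ^ (n - i))"
        by (simp add: qfact_def)
      with Suc.IH[of "Suc i"] False \<open>i \<le> n\<close> show ?thesis
        by (metis Suc_leI le_neq_implies_less mult.assoc)
    qed
    have "qfact Q (Suc i) = qfact Q i * (1 - Q ^ Suc i)"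
      by (simp add: qfact_def)
    then have second: "Q ^ (n - i) * qbinom Q n i * qfact Q (Suc i) * qfact Q (n - i)
        = qfact Q n * (Q ^ (n - i) * (1 - Q ^ Suc i))"
      by (simp only: mult_ac flip: Suc.IH[OF \<open>i \<le> n\<close>])
    have "Q ^ Suc n = Q ^ (n - i) * Q ^ Suc i"
      using \<open>i \<le> n\<close> by (simp flip: power_add power_Suc)
    then have "qfact Q (Suc n) = qfact Q n * (1 - Q ^ (n - i) * Q ^ Suc i)"
      by (simp add: qfact_def)
    also have "\<dots> = qfact Q n * (1 - Q ^ (n - i)) + qfact Q n * (Q ^ (n - i) * (1 - Q ^ Suc i))"
      by (simp add: algebra_simps)
    finally show ?thesis
      unfolding Suc by (simp add: distrib_right first second)
  qed
qed

lemma choose_two_Suc: "Suc n choose 2 = (n choose 2) + n"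
  by (simp add: numeral_2_eq_2)

lemma choose_two_add: "(m + n) choose 2 = (m choose 2) + (n choose 2) + m * n"
  by (induction n) (simp_all add: choose_two_Suc numeral_2_eq_2)

text \<open>Multiplying by the new factor \<open>y + x * Q ^ N\<close> reproduces the q-Pascal rule.
  The homogeneous form permits \<open>y = Q ^ N\<close> later, which avoids negative powers of
  \<open>Q\<close>.\<close>

lemma qbinomial_theorem:
  "(\<Prod>m<N. y + x * Q ^ m) = (\<Sum>l\<le>N. qbinom Q N l * Q ^ (l choose 2) * x ^ l * y ^ (N - l))"
proof (induction N)
  case 0
  then show ?case by (simp add: numeral_2_eq_2)
next
  case (Suc N)
  let ?t = "\<lambda>N l. qbinom Q N l * Q ^ (l choose 2) * x ^ l * y ^ (N - l)"
  have step: "?t (Suc N) (Suc l) = y * ?t N (Suc l) + x * Q ^ N * ?t N l" if "l \<le> N" for l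
  proof -
    have "Q ^ (Suc l choose 2) * Q ^ (N - l) = Q ^ N * Q ^ (l choose 2)"
      using that by (simp add: choose_two_Suc add.commute flip: power_add)
    then have "qbinom Q N l * (Q ^ (Suc l choose 2) * Q ^ (N - l)) = qbinom Q N l * (Q ^ N * Q ^ (l choose 2))"
      by (rule arg_cong)
    then have "Q ^ (N - l) * qbinom Q N l * Q ^ (Suc l choose 2) = Q ^ N * (qbinom Q N l * Q ^ (l choose 2))"
      (is "?a = ?a'") by (simp only: mult_ac)
    moreover have "qbinom Q N (Suc l) * y ^ (N - l) = y * qbinom Q N (Suc l) * y ^ (N - Suc l)"
      (is "?b = ?b'")
    proof (cases "l = N")
      case False
      with that have "N - l = Suc (N - Suc l)" by simp
      then show ?thesis by simp
    qed (simp add: qbinom_eq_0)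
    moreover have "?t (Suc N) (Suc l) = ?b * (Q ^ (Suc l choose 2) * x ^ Suc l) + ?a * (x ^ Suc l * y ^ (N - l))"
      by (simp add: algebra_simps)
    moreover have "?b' * (Q ^ (Suc l choose 2) * x ^ Suc l) + ?a' * (x ^ Suc l * y ^ (N - l))
        = y * ?t N (Suc l) + x * Q ^ N * ?t N l"
      by (simp add: mult_ac)
    ultimately show ?thesis by (simp only:)
  qed
  have "(\<Sum>l\<le>Suc N. ?t (Suc N) l) = ?t (Suc N) 0 + (\<Sum>l\<le>N. ?t (Suc N) (Suc l))"
    by (rule sum.atMost_Suc_shift)
  also have "(\<Sum>l\<le>N. ?t (Suc N) (Suc l)) = y * (\<Sum>l\<le>N. ?t N (Suc l)) + x * Q ^ N * (\<Sum>l\<le>N. ?t N l)"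
    unfolding sum_distrib_left sum.distrib[symmetric] by (intro sum.cong refl step) simp
  also have "?t (Suc N) 0 = y * ?t N 0"
    by simp
  also have "y * ?t N 0 + (y * (\<Sum>l\<le>N. ?t N (Suc l)) + x * Q ^ N * (\<Sum>l\<le>N. ?t N l))
      = y * (?t N 0 + (\<Sum>l\<le>N. ?t N (Suc l))) + x * Q ^ N * (\<Sum>l\<le>N. ?t N l)"
    by (simp only: distrib_left add.assoc)
  also have "?t N 0 + (\<Sum>l\<le>N. ?t N (Suc l)) = (\<Sum>l\<le>Suc N. ?t N l)"
    by (rule sum.atMost_Suc_shift[symmetric])
  also have "\<dots> = (\<Sum>l\<le>N. ?t N l)"
    by (simp add: qbinom_eq_0)
  finally show ?case
    using Suc.IH by (simp add: algebra_simps)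
qed

text \<open>The finite Jacobi triple product, with \<open>w\<close> in the role of Q/z. It is the
  q-binomial theorem for \<open>2 * N\<close> factors at \<open>x = - z\<close>,
  \<open>y = Q ^ N\<close>, with the sum recentred at \<open>l = N\<close>: indices from
  \<open>N\<close> on give powers of \<open>z\<close>, smaller ones powers of
  \<open>w\<close>.\<close>

lemma finite_triple_product:
  fixes z w :: "'a::idom"
  assumes "z * w = Q" "Q \<noteq> 0"
  shows "(\<Prod>m<N. (1 - z * Q ^ m) * (1 - w * Q ^ m)) =
    (\<Sum>s\<le>N. (-1) ^ s * qbinom Q (2 * N) (N + s) * Q ^ (s choose 2) * z ^ s) +
    (\<Sum>s<N. (-1) ^ Suc s * qbinom Q (2 * N) (N - Suc s) * Q ^ (Suc s choose 2) * w ^ Suc s)"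
    (is "?P = ?A + ?B")
proof -
  \<comment> \<open>The monomial pulled out of the product: the first \<open>N\<close> factors yield
    \<open>- z * Q ^ m\<close> each, the last \<open>N\<close> factors \<open>Q ^ N\<close>
    each.\<close>
  define D where "D = (- z) ^ N * Q ^ (N * N + (N choose 2))"
  let ?t = "\<lambda>l. qbinom Q (2 * N) l * Q ^ (l choose 2) * (- z) ^ l * (Q ^ N) ^ (2 * N - l)"
  have "z \<noteq> 0" using assms by auto
  then have "D \<noteq> 0" using assms by (simp add: D_def)
  have split: "(\<Prod>m<N + M. f m) = (\<Prod>m<N. f m) * (\<Prod>m<M. f (N + m))" for M and f :: "nat \<Rightarrow> 'a"
    by (induction M) (simp_all add: mult.assoc)
  have "(\<Prod>m<2 * N. Q ^ N + (- z) * Q ^ m) = (\<Prod>m<N. Q ^ N + (- z) * Q ^ m) * (\<Prod>m<N. Q ^ N + (- z) * Q ^ (N + m))"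
    by (simp only: mult_2 split)
  \<comment> \<open>One factor \<open>Q\<close> of \<open>Q ^ N\<close> is written as
    \<open>z * w\<close>; the resulting \<open>w\<close>-factors appear in reverse order.\<close>
  also have "(\<Prod>m<N. Q ^ N + (- z) * Q ^ m) = (\<Prod>m<N. (- z) * Q ^ m * (1 - w * Q ^ (N - Suc m)))"
  proof (rule prod.cong[OF refl])
    fix m assume "m \<in> {..<N}"
    then have "N = Suc m + (N - Suc m)" by simp
    then have "Q ^ N = Q ^ m * Q * Q ^ (N - Suc m)"
      by (metis power_Suc2 power_add)
    then show "Q ^ N + (- z) * Q ^ m = (- z) * Q ^ m * (1 - w * Q ^ (N - Suc m))"
      by (simp add: algebra_simps flip: assms(1))
  qed
  also have "\<dots> = (- z) ^ N * Q ^ (N choose 2) * (\<Prod>m<N. 1 - w * Q ^ m)"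
  proof -
    have "(\<Prod>m<N. Q ^ m) = Q ^ (N choose 2)"
      by (induction N) (simp_all add: choose_two_Suc power_add numeral_2_eq_2)
    then show ?thesis
      by (simp only: prod.distrib prod.nat_diff_reindex[of "\<lambda>m. 1 - w * Q ^ m"] prod_constant card_lessThan)
  qed
  also have "(\<Prod>m<N. Q ^ N + (- z) * Q ^ (N + m)) = (\<Prod>m<N. Q ^ N * (1 - z * Q ^ m))"
    by (simp add: power_add algebra_simps)
  also have "\<dots> = Q ^ (N * N) * (\<Prod>m<N. 1 - z * Q ^ m)"
    by (simp add: prod.distrib power_mult)
  finally have "(\<Prod>m<2 * N. Q ^ N + (- z) * Q ^ m) = D * ?P"
    by (simp add: D_def prod.distrib power_add mult_ac)
  then have "D * ?P = (\<Sum>l\<le>2 * N. ?t l)"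
    by (simp only: qbinomial_theorem)
  also have "\<dots> = (\<Sum>l<N. ?t l) + (\<Sum>s\<le>N. ?t (N + s))"
  proof -
    have "{..2 * N} = {..<N} \<union> {N..N + N}" "{..<N} \<inter> {N..N + N} = {}" by auto
    then have "(\<Sum>l\<le>2 * N. ?t l) = (\<Sum>l<N. ?t l) + (\<Sum>l\<in>{N..N + N}. ?t l)"
      by (simp add: sum.union_disjoint)
    moreover have "(\<Sum>l\<in>{N..N + N}. ?t l) = (\<Sum>s\<le>N. ?t (N + s))"
      using sum.shift_bounds_cl_nat_ivl[of ?t 0 N N] by (simp add: atMost_atLeast0 add.commute)
    ultimately show ?thesis by simp
  qed
  also have "(\<Sum>l<N. ?t l) = (\<Sum>s<N. ?t (N - Suc s))"
    by (rule sum.nat_diff_reindex[symmetric])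
  also have "\<dots> = D * ?B"
    unfolding sum_distrib_left
  proof (rule sum.cong[OF refl])
    fix s assume "s \<in> {..<N}"
    then obtain r where N: "N = r + Suc s" by (metis lessThan_iff less_imp_Suc_add add.commute add_Suc_right)
    have square: "Suc n * Suc n = 2 * (Suc n choose 2) + Suc n" for n
      by (induction n) (simp_all add: choose_two_Suc)
    have "N choose 2 = (r choose 2) + (Suc s choose 2) + r * Suc s"
      unfolding N by (rule choose_two_add)
    moreover have "N * Suc s = r * Suc s + Suc s * Suc s"
      unfolding N by (rule distrib_right)
    ultimately have "(r choose 2) + N * (N + Suc s) = Suc s + (N * N + (N choose 2) + (Suc s choose 2))"
      using square[of s] by (simp only: distrib_left)
    then have q: "Q ^ (r choose 2) * Q ^ (N * (N + Suc s)) =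
        Q ^ Suc s * (Q ^ (N * N + (N choose 2)) * Q ^ (Suc s choose 2))"
      by (simp only: power_add[symmetric])
    have l: "N - Suc s = r" "2 * N - (N - Suc s) = N + Suc s" by (simp_all add: N)
    \<comment> \<open>The surplus \<open>Q ^ Suc s = z ^ Suc s * w ^ Suc s\<close> completes
      \<open>(- z) ^ r\<close> to \<open>(- z) ^ N\<close> and leaves the power of
      \<open>w\<close>.\<close>
    have z: "(- z) ^ r * Q ^ Suc s = (- z) ^ N * (- 1) ^ Suc s * w ^ Suc s"
      by (simp add: N power_add power_mult_distrib power_minus[of z] mult_ac flip: assms(1))
    have "?t (N - Suc s) = qbinom Q (2 * N) (N - Suc s) * (Q ^ (r choose 2) * Q ^ (N * (N + Suc s))) * (- z) ^ r"
      unfolding l(2) by (simp only: l(1) power_mult mult_ac)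
    also have "\<dots> = qbinom Q (2 * N) (N - Suc s) * (Q ^ (N * N + (N choose 2)) * Q ^ (Suc s choose 2)) * ((- z) ^ r * Q ^ Suc s)"
      by (simp only: q mult_ac)
    finally show "?t (N - Suc s) = D * ((-1) ^ Suc s * qbinom Q (2 * N) (N - Suc s) * Q ^ (Suc s choose 2) * w ^ Suc s)"
      unfolding z D_def by (simp only: mult_ac)
  qed
  also have "(\<Sum>s\<le>N. ?t (N + s)) = D * ?A"
    unfolding sum_distrib_left
  proof (rule sum.cong[OF refl])
    fix s assume "s \<in> {..N}"
    then obtain r where N: "N = r + s" by (metis atMost_iff le_Suc_ex add.commute)
    have "(N + s choose 2) + N * r = (N * N + (N choose 2)) + (s choose 2)"
      by (simp add: choose_two_add N algebra_simps)
    then have q: "Q ^ (N + s choose 2) * Q ^ (N * r) = Q ^ (N * N + (N choose 2)) * Q ^ (s choose 2)"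
      by (simp flip: power_add)
    have r: "2 * N - (N + s) = r" by (simp add: N)
    have "(- z) ^ (N + s) = (- z) ^ N * ((-1) ^ s * z ^ s)"
      by (simp add: power_add power_minus[of z])
    then have "?t (N + s) = qbinom Q (2 * N) (N + s) * (Q ^ (N + s choose 2) * Q ^ (N * r))
        * ((- z) ^ N * ((-1) ^ s * z ^ s))"
      unfolding r by (simp only: power_mult mult_ac)
    then show "?t (N + s) = D * ((-1) ^ s * qbinom Q (2 * N) (N + s) * Q ^ (s choose 2) * z ^ s)"
      unfolding q D_def by (simp only: mult_ac)
  qed
  finally have "D * ?P = D * (?A + ?B)" by (simp add: algebra_simps)
  with \<open>D \<noteq> 0\<close> show ?thesis by simp
qed

section \<open>The recursion for the numerators\<close>

definition numer_term :: "nat \<Rightarrow> nat \<Rightarrow> nat \<Rightarrow> nat \<Rightarrow> nat \<Rightarrow> complex fps" where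
  "numer_term k j a c l =
    (-1) ^ l * fps_X ^ ((2 * k + 1) * (l choose 2) + (k * (j + 1) + a) * l)
      * (\<Prod>m = 1..j. 1 - fps_X ^ (l + m)) * (1 - fps_X ^ (c * (2 * l + j + 1)))"

definition numer :: "nat \<Rightarrow> nat \<Rightarrow> nat \<Rightarrow> nat \<Rightarrow> complex fps" where
  "numer k j a c = suminf (numer_term k j a c)"

text \<open>
  When \<open>a + c = k + 1\<close>, \<^term>\<open>numer k j a c\<close> is the numerator of \<open>H_{(k-1)j+a}\<close>.
  Keeping \<open>c\<close> as a separate argument makes the boundary case \<open>a = k + 1\<close>, \<open>c = 0\<close> available,
  where it vanishes.
\<close>

definition euler :: "complex fps" where
  "euler = prodinf (\<lambda>n. 1 - fps_X ^ Suc n)"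

lemma H_eq_numer: "H k j i = numer k j i (k - i + 1) / euler"
  unfolding H_def numer_def euler_def numer_term_def ..

lemma numer_c_0: "numer k j a 0 = 0"
proof -
  have "numer_term k j a 0 = (\<lambda>_. 0)"
    by (simp add: numer_term_def fun_eq_iff)
  then show ?thesis by (simp add: numer_def)
qed

lemma numer_cong:
  assumes "1 \<le> k"
  shows "fps_cong N (numer k j a c) (\<Sum>l<N. numer_term k j a c l)"
  unfolding numer_def
proof (rule fps_cong_suminf)
  fix l
  have "l \<le> k * (j + 1) * l" using assms by simp
  then have "l \<le> (2 * k + 1) * (l choose 2) + (k * (j + 1) + a) * l"
    unfolding distrib_right by linarith
  then have "fps_cong l (fps_X ^ ((2 * k + 1) * (l choose 2) + (k * (j + 1) + a) * l) *
      ((-1) ^ l * (\<Prod>m = 1..j. 1 - fps_X ^ (l + m)) * (1 - fps_X ^ (c * (2 * l + j + 1))))) (0 :: complex fps)"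
    by (rule fps_cong_X_power_mult_0)
  then show "fps_cong l (numer_term k j a c l) 0"
    by (simp add: numer_term_def mult_ac)
qed

lemma prod_shift_last:
  fixes l j :: nat
  shows "(\<Prod>m = 1..j. 1 - fps_X ^ (l + m)) * (1 - fps_X ^ (l + j + 1)) =
    (\<Prod>m = 1..Suc j. 1 - fps_X ^ (l + m) :: complex fps)"
  by simp

text \<open>With \<open>prod_shift_last\<close> this shows that the product for \<open>j\<close> at
  index \<open>l\<close>, completed at its end, and the one at index \<open>l + 1\<close>, completed
  at its beginning, are the same product for \<open>j + 1\<close>. Hence the shifted halves in
  \<open>numer_rec\<close> combine.\<close>

lemma prod_shift_first:
  fixes l j :: nat
  shows "(\<Prod>m = 1..j. 1 - fps_X ^ (Suc l + m)) * (1 - fps_X ^ Suc l) =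
    (\<Prod>m = 1..Suc j. 1 - fps_X ^ (l + m) :: complex fps)"
  by (induction j) (simp_all add: mult_ac)

text \<open>Each difference of summands is \<open>u l + v l\<close>, and
  \<open>u (Suc l) + v l\<close> is a single summand for \<open>j + 1\<close>. As
  \<open>u 0 = 0\<close>, the shift loses nothing at the lower end; at the upper end the remainder
  \<open>v N\<close> vanishes modulo \<open>fps_X ^ N\<close>.\<close>

lemma numer_rec:
  assumes "1 \<le> a" "a + c = k + 1" "1 \<le> k"
  shows "fps_X ^ ((a - 1) * (j + 1)) * numer k (j + 1) a c = numer k j c a - numer k j (c + 1) (a - 1)"
proof (rule fps_cong_imp_eq)
  fix N
  obtain b where a: "a = Suc b" using assms(1) by (cases a) auto
  have k: "k = b + c" using assms(2) a by simp
  let ?X = "fps_X :: complex fps"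
  define T where "T l = (2 * k + 1) * (l choose 2) + k * (j + 1) * l" for l
  define P where "P l = (\<Prod>m = 1..Suc j. 1 - ?X ^ (l + m))" for l
  define p where "p l = (\<Prod>m = 1..j. 1 - ?X ^ (l + m))" for l
  \<comment> \<open>Since \<open>a = b + 1\<close>, the exponent \<open>a * (2 * l + j + 1)\<close>
    is the sum of \<open>l + b * (2 * l + j + 1)\<close> and \<open>l + j + 1\<close>. Adding and
    subtracting the power with exponent \<open>l + b * (2 * l + j + 1)\<close> inside the common
    factor separates \<open>1 - ?X ^ l\<close> from \<open>1 - ?X ^ (l + j + 1)\<close>.\<close>
  define u where "u l = (-1) ^ l * ?X ^ (T l + c * l) * p l * (1 - ?X ^ l)" for l
  define v where "v l = (-1) ^ l * ?X ^ (T l + (c + 1) * l + b * (2 * l + j + 1)) * P l" for l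
  have uv: "numer_term k j c a l - numer_term k j (c + 1) b l = u l + v l" for l
  proof -
    have P: "P l = p l * (1 - ?X ^ (l + j + 1))"
      unfolding P_def p_def by (rule prod_shift_last[symmetric])
    have e: "?X ^ (T l + (c + 1) * l + b * (2 * l + j + 1)) * ?X ^ (l + j + 1) =
        ?X ^ (T l + c * l) * ?X ^ (a * (2 * l + j + 1))"
      "?X ^ (T l + (c + 1) * l + b * (2 * l + j + 1)) = ?X ^ (T l + (c + 1) * l) * ?X ^ (b * (2 * l + j + 1))"
      "?X ^ (T l + (c + 1) * l) = ?X ^ (T l + c * l) * ?X ^ l"
      unfolding power_add[symmetric] by (rule arg_cong[of _ _ "\<lambda>e. ?X ^ e"], simp add: a algebra_simps)+
    have n1: "numer_term k j c a l = (-1) ^ l * ?X ^ (T l + c * l) * p l * (1 - ?X ^ (a * (2 * l + j + 1)))"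
      unfolding numer_term_def p_def T_def by (simp add: distrib_right add.assoc)
    have n2: "numer_term k j (c + 1) b l = (-1) ^ l * ?X ^ (T l + (c + 1) * l) * p l * (1 - ?X ^ (b * (2 * l + j + 1)))"
      unfolding numer_term_def p_def T_def by (simp only: distrib_right add.assoc)
    have alg: "s * A * p * (1 - F) - s * B * p * (1 - D) = s * A * p * (1 - L) + s * (B * D) * (p * (1 - M))"
      if "B * D * M = A * F" "B = A * L" for s A B D F L M p :: "complex fps"
    proof -
      have "s * (B * D) * (p * (1 - M)) = s * p * (B * D) - s * p * (B * D * M)"
        by (simp add: algebra_simps)
      also have "\<dots> = s * p * (B * D) - s * p * (A * F)"
        by (simp only: that(1))
      finally show ?thesis
        by (simp only:) (simp add: that(2) algebra_simps)
    qed
    show ?thesis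
      unfolding n1 n2 u_def v_def P unfolding e(2)
      by (rule alg) (use e in \<open>simp_all only:\<close>)
  qed
  have shift: "u (Suc l) + v l = ?X ^ ((a - 1) * (j + 1)) * numer_term k (j + 1) a c l" for l
  proof -
    define S where "S = (2 * k + 1) * (l choose 2) + (k * (j + 1 + 1) + a) * l"
    have e1: "T (Suc l) + c * Suc l = b * (j + 1) + S + c * (2 * l + (j + 1) + 1)"
      unfolding T_def S_def choose_two_Suc by (simp add: a k algebra_simps)
    have e2: "T l + (c + 1) * l + b * (2 * l + j + 1) = b * (j + 1) + S"
      unfolding T_def S_def by (simp add: a k algebra_simps)
    have u: "u (Suc l) = - ((-1) ^ l * ?X ^ (b * (j + 1) + S + c * (2 * l + (j + 1) + 1)) * P l)"
      unfolding u_def e1 P_def p_def prod_shift_first[symmetric] by (simp only: mult_ac power_Suc) simp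
    have n: "numer_term k (j + 1) a c l = (-1) ^ l * ?X ^ S * P l * (1 - ?X ^ (c * (2 * l + (j + 1) + 1)))"
      unfolding numer_term_def S_def P_def by simp
    show ?thesis
      unfolding u n v_def e2 by (simp add: a power_add algebra_simps)
  qed
  have "(\<Sum>l<Suc N. numer_term k j c a l) - (\<Sum>l<Suc N. numer_term k j (c + 1) b l)
      = (\<Sum>l<Suc N. u l) + (\<Sum>l<Suc N. v l)"
    by (simp only: uv sum.distrib flip: sum_subtractf)
  \<comment> \<open>The factor \<open>1 - ?X ^ l\<close> vanishes at \<open>l = 0\<close>.\<close>
  also have "(\<Sum>l<Suc N. u l) = (\<Sum>l<N. u (Suc l))"
    by (subst sum.lessThan_Suc_shift) (simp add: u_def)
  also have "\<dots> + (\<Sum>l<Suc N. v l) = ?X ^ ((a - 1) * (j + 1)) * (\<Sum>l<N. numer_term k (j + 1) a c l) + v N"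
    unfolding sum_distrib_left shift[symmetric] sum.distrib by (simp add: add.assoc)
  finally have S: "(\<Sum>l<Suc N. numer_term k j c a l) - (\<Sum>l<Suc N. numer_term k j (c + 1) b l) =
      ?X ^ ((a - 1) * (j + 1)) * (\<Sum>l<N. numer_term k (j + 1) a c l) + v N" .
  have "fps_cong N (?X ^ (T N + (c + 1) * N + b * (2 * N + j + 1)) * ((-1) ^ N * P N)) 0"
    by (rule fps_cong_X_power_mult_0) simp
  then have v: "fps_cong N (v N) 0"
    by (simp add: v_def mult_ac)
  have "fps_cong N (?X ^ ((a - 1) * (j + 1)) * numer k (j + 1) a c + 0)
      (?X ^ ((a - 1) * (j + 1)) * (\<Sum>l<N. numer_term k (j + 1) a c l) + v N)"
    using assms(3) by (intro fps_cong_add fps_cong_mult fps_cong_refl numer_cong fps_cong_sym[OF v])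
  moreover have "fps_cong (Suc N) (numer k j c a - numer k j (c + 1) b)
      ((\<Sum>l<Suc N. numer_term k j c a l) - (\<Sum>l<Suc N. numer_term k j (c + 1) b l))"
    using assms(3) by (intro fps_cong_diff numer_cong)
  then have "fps_cong N (numer k j c a - numer k j (c + 1) b)
      ((\<Sum>l<Suc N. numer_term k j c a l) - (\<Sum>l<Suc N. numer_term k j (c + 1) b l))"
    by (rule fps_cong_mono) simp
  ultimately show "fps_cong N (?X ^ ((a - 1) * (j + 1)) * numer k (j + 1) a c)
      (numer k j c a - numer k j (c + 1) (a - 1))"
    unfolding S by (simp add: a fps_cong_def)
qed

section \<open>The initial products\<close>

lemma euler_cong: "N \<le> L \<Longrightarrow> fps_cong N euler (\<Prod>m<L. 1 - fps_X ^ Suc m)"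
  unfolding euler_def
  by (rule fps_cong_prodinf) (auto intro: fps_cong_1_minus_X_power simp del: power_Suc)

lemma euler_nth_0: "euler $ 0 = 1"
  using euler_cong[of 1 1] by (simp add: fps_cong_def)

lemma euler_nonzero: "euler \<noteq> 0"
  using euler_nth_0 by auto

text \<open>By \<open>qbinom_qfact\<close>, the left side is the product of the quotients
  \<open>qfact X (2 * N) / qfact X (N + t)\<close> and \<open>qfact X N / qfact X (N - t)\<close>.
  Both consist of factors \<open>1 - X ^ Suc i\<close> with \<open>i \<ge> N - t\<close>.\<close>

lemma qbinom_qfact_cong:
  fixes X :: "complex fps"
  assumes "X = fps_X ^ d" "1 \<le> d" "t \<le> N" "l = N + t \<or> l = N - t"
  shows "fps_cong (N - t) (qbinom X (2 * N) l * qfact X N) 1"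
proof -
  have R: "\<exists>R. qfact X n = qfact X m * R \<and> fps_cong m R 1" if "m \<le> n" for m n
  proof (intro exI conjI)
    show "qfact X n = qfact X m * (\<Prod>i\<in>{m..<n}. 1 - X ^ Suc i)"
      using that by (simp add: qfact_def prod.atLeastLessThan_concat lessThan_atLeast0)
    have "fps_cong m (\<Prod>i\<in>{m..<n}. 1 - X ^ Suc i) (\<Prod>i\<in>{m..<n}. 1)"
    proof (rule fps_cong_prod)
      fix i assume "i \<in> {m..<n}"
      then have "m \<le> i" by simp
      also have "i \<le> d * Suc i" using assms(2) by (cases d) auto
      finally show "fps_cong m (1 - X ^ Suc i) 1"
        unfolding assms(1) power_mult[symmetric] by (rule fps_cong_1_minus_X_power)
    qed
    then show "fps_cong m (\<Prod>i\<in>{m..<n}. 1 - X ^ Suc i) 1" by simp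
  qed
  have nz: "qfact X n \<noteq> 0" for n
  proof -
    have "(1 - X ^ Suc i) $ 0 = 1" for i
      using assms(2) by (simp add: assms(1) fps_X_power_nth flip: power_mult power_Suc)
    then have "1 - X ^ Suc i \<noteq> 0" for i by (metis fps_zero_nth zero_neq_one)
    then show ?thesis by (simp add: qfact_def del: power_Suc)
  qed
  have q: "qbinom X (2 * N) l * qfact X (N - t) * qfact X (N + t) = qfact X (2 * N)"
    using assms(3,4) qbinom_qfact[of l "2 * N" X] by (auto simp: mult_ac)
  obtain R where R1: "qfact X (2 * N) = qfact X (N + t) * R" "fps_cong (N + t) R 1"
    using R[of "N + t" "2 * N"] assms(3) by auto
  obtain S where S1: "qfact X N = qfact X (N - t) * S" "fps_cong (N - t) S 1"
    using R[of "N - t" N] by auto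
  have "qbinom X (2 * N) l * qfact X (N - t) = R"
    using q nz[of "N + t"] unfolding R1(1) by (simp add: mult_ac)
  then have "qbinom X (2 * N) l * qfact X N = R * S"
    by (simp add: S1(1) mult.assoc[symmetric])
  then show ?thesis
    using fps_cong_mult[OF fps_cong_mono[OF R1(2), of "N - t"] S1(2)] by simp
qed

text \<open>The finite triple product at \<open>z = fps_X ^ (k + i)\<close>,
  \<open>w = fps_X ^ (k - i + 1)\<close>, multiplied by \<open>qfact Q N\<close>, which makes the
  Gaussian coefficients congruent to 1. The \<open>z\<close>-term \<open>s\<close> and the
  \<open>w\<close>-term \<open>Suc s\<close> then merge into one summand of the numerator for
  \<open>j = 0\<close>.\<close>

lemma triple_product_cong:
  assumes "1 \<le> k" "1 \<le> i" "i \<le> k"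
  defines "Q \<equiv> fps_X ^ (2 * k + 1)"
  shows "fps_cong N (\<Prod>m<N. (1 - fps_X ^ (k + i) * Q ^ m) * (1 - fps_X ^ (k - i + 1) * Q ^ m) * (1 - Q ^ Suc m))
    (numer k 0 i (k - i + 1))"
proof -
  define z w :: "complex fps" where "z = fps_X ^ (k + i)" and "w = fps_X ^ (k - i + 1)"
  have zw: "z * w = Q" using assms(3) by (simp add: z_def w_def Q_def flip: power_add)
  have Q0: "Q \<noteq> 0" by (simp add: Q_def)
  have zp: "z ^ s = fps_X ^ ((k + i) * s)" and wp: "w ^ s = fps_X ^ ((k - i + 1) * s)" for s
    by (simp_all only: z_def w_def power_mult)
  \<comment> \<open>The coefficient is 1 only modulo \<open>fps_X ^ (N - s)\<close>, but the
    monomial beside it has exponent at least \<open>s\<close>, so the congruence holds modulo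
    \<open>fps_X ^ N\<close>.\<close>
  have term_cong: "fps_cong N (qbinom Q (2 * N) l * qfact Q N * (Q ^ (s choose 2) * fps_X ^ (h * s)))
      (Q ^ (s choose 2) * fps_X ^ (h * s))"
    if "s \<le> N" "1 \<le> h" "l = N + s \<or> l = N - s" for l s h
  proof -
    define e where "e = (2 * k + 1) * (s choose 2) + h * s"
    have e: "Q ^ (s choose 2) * fps_X ^ (h * s) = fps_X ^ e"
      by (simp only: Q_def e_def power_add[symmetric] power_mult[symmetric])
    have "s \<le> h * s" using that(2) by simp
    then have "N \<le> e + (N - s)" using that(1) unfolding e_def by linarith
    moreover have "fps_cong (e + (N - s)) (fps_X ^ e * (qbinom Q (2 * N) l * qfact Q N)) (fps_X ^ e * 1)"
      by (rule fps_cong_X_power_mult, rule qbinom_qfact_cong[OF Q_def[THEN meta_eq_to_obj_eq]]) (use that in auto)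
    ultimately have "fps_cong N (fps_X ^ e * (qbinom Q (2 * N) l * qfact Q N)) (fps_X ^ e * 1)"
      by (rule fps_cong_mono[rotated])
    then show ?thesis unfolding e by (simp only: mult_1_right mult.commute[of "fps_X ^ e"])
  qed
  let ?z = "\<lambda>s. (-1) ^ s * (Q ^ (s choose 2) * fps_X ^ ((k + i) * s)) :: complex fps"
  let ?w = "\<lambda>s. (-1) ^ s * (Q ^ (s choose 2) * fps_X ^ ((k - i + 1) * s)) :: complex fps"
  have "(\<Prod>m<N. (1 - z * Q ^ m) * (1 - w * Q ^ m) * (1 - Q ^ Suc m))
      = (\<Prod>m<N. (1 - z * Q ^ m) * (1 - w * Q ^ m)) * qfact Q N"
    by (simp add: qfact_def prod.distrib)
  also have "\<dots> = ((\<Sum>s\<le>N. (-1) ^ s * qbinom Q (2 * N) (N + s) * Q ^ (s choose 2) * fps_X ^ ((k + i) * s)) +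
    (\<Sum>s<N. (-1) ^ Suc s * qbinom Q (2 * N) (N - Suc s) * Q ^ (Suc s choose 2) * fps_X ^ ((k - i + 1) * Suc s))) * qfact Q N"
    by (simp only: finite_triple_product[OF zw Q0] zp wp)
  also have "\<dots> = (\<Sum>s\<le>N. (-1) ^ s * (qbinom Q (2 * N) (N + s) * qfact Q N * (Q ^ (s choose 2) * fps_X ^ ((k + i) * s)))) +
    (\<Sum>s<N. (-1) ^ Suc s * (qbinom Q (2 * N) (N - Suc s) * qfact Q N * (Q ^ (Suc s choose 2) * fps_X ^ ((k - i + 1) * Suc s))))"
    unfolding distrib_right[where c = "qfact Q N"] sum_distrib_right by (simp only: mult_ac)
  finally have prod: "(\<Prod>m<N. (1 - z * Q ^ m) * (1 - w * Q ^ m) * (1 - Q ^ Suc m)) = \<dots>" .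
  have "fps_cong N (\<Prod>m<N. (1 - z * Q ^ m) * (1 - w * Q ^ m) * (1 - Q ^ Suc m))
      ((\<Sum>s\<le>N. ?z s) + (\<Sum>s<N. ?w (Suc s)))"
    unfolding prod
    by (rule fps_cong_add; rule fps_cong_sum; rule fps_cong_mult[OF fps_cong_refl]; rule term_cong)
      (use assms(2) in auto)
  then have P: "fps_cong N (\<Prod>m<N. (1 - z * Q ^ m) * (1 - w * Q ^ m) * (1 - Q ^ Suc m))
      ((\<Sum>s<N. ?z s) + (\<Sum>s<N. ?w (Suc s)))"
  proof (rule fps_cong_trans)
    \<comment> \<open>The \<open>z\<close>-sum has one more term than the \<open>w\<close>-sum; this
      last term is 0 modulo \<open>fps_X ^ N\<close>.\<close>
    have "N \<le> (k + i) * N" using assms(1) by simp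
    then have "fps_cong N (fps_X ^ ((k + i) * N) * ((-1) ^ N * Q ^ (N choose 2))) (0 :: complex fps)"
      by (rule fps_cong_X_power_mult_0)
    then have "fps_cong N (?z N) 0" by (simp add: mult_ac)
    then show "fps_cong N ((\<Sum>s\<le>N. ?z s) + (\<Sum>s<N. ?w (Suc s))) ((\<Sum>s<N. ?z s) + (\<Sum>s<N. ?w (Suc s)))"
      by (simp add: fps_cong_def flip: lessThan_Suc_atMost)
  qed
  have S: "(\<Sum>s<N. ?z s) + (\<Sum>s<N. ?w (Suc s)) = (\<Sum>s<N. numer_term k 0 i (k - i + 1) s)"
    unfolding sum.distrib[symmetric]
  proof (rule sum.cong[OF refl])
    fix s
    obtain c where k: "k = c + i" using assms(3) by (metis le_Suc_ex add.commute)
    \<comment> \<open>The exponent of the \<open>w\<close>-term exceeds that of the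
      \<open>z\<close>-term by \<open>(k - i + 1) * (2 * s + 1)\<close>, the exponent in the last
      factor of \<open>numer_term\<close> for \<open>j = 0\<close>.\<close>
    have "(2 * k + 1) * (Suc s choose 2) + (k - i + 1) * Suc s =
        (2 * k + 1) * (s choose 2) + (k + i) * s + (k - i + 1) * (2 * s + 1)"
      by (simp add: k choose_two_Suc algebra_simps)
    then have "Q ^ (Suc s choose 2) * fps_X ^ ((k - i + 1) * Suc s) =
        Q ^ (s choose 2) * fps_X ^ ((k + i) * s) * fps_X ^ ((k - i + 1) * (2 * s + 1))"
      unfolding Q_def by (simp only: power_add[symmetric] power_mult[symmetric])
    then have w: "?w (Suc s) = - ((-1) ^ s * (Q ^ (s choose 2) * fps_X ^ ((k + i) * s) * fps_X ^ ((k - i + 1) * (2 * s + 1))))"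
      by simp
    have n: "numer_term k 0 i (k - i + 1) s =
        (-1) ^ s * (Q ^ (s choose 2) * fps_X ^ ((k + i) * s)) * (1 - fps_X ^ ((k - i + 1) * (2 * s + 1)))"
    proof -
      have e: "Q ^ (s choose 2) * fps_X ^ ((k + i) * s) = fps_X ^ ((2 * k + 1) * (s choose 2) + (k + i) * s)"
        by (simp only: Q_def power_add[symmetric] power_mult[symmetric])
      show ?thesis
        unfolding e by (simp add: numer_term_def)
    qed
    have "x * y + - (x * (y * t)) = x * y * (1 - t)" for x y t :: "complex fps"
      by (simp add: algebra_simps)
    then show "?z s + ?w (Suc s) = numer_term k 0 i (k - i + 1) s"
      unfolding w n .
  qed
  show ?thesis
    using P fps_cong_sym[OF numer_cong[OF assms(1)]] unfolding S z_def w_def by (rule fps_cong_trans)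
qed

definition excluded :: "nat \<Rightarrow> nat \<Rightarrow> nat \<Rightarrow> bool" where
  "excluded k i n \<longleftrightarrow> [int n = 0] (mod 2 * int k + 1) \<or>
        [int n = int k + 1 - int i] (mod 2 * int k + 1) \<or>
        [int n = - (int k + 1 - int i)] (mod 2 * int k + 1)"

text \<open>The factor of index \<open>m\<close> has exponent \<open>Suc m\<close>, so a block of
  \<open>2 * k + 1\<close> indices runs through the residues 1 to \<open>2 * k + 1\<close>. The
  excluded ones are \<open>k + 1 - i\<close>, \<open>k + i\<close> and \<open>2 * k + 1\<close>,
  each lowered by one here.\<close>

lemma excluded_block:
  assumes "1 \<le> i" "i \<le> k" "n < 2 * k + 1"
  shows "excluded k i (Suc ((2 * k + 1) * N + n)) \<longleftrightarrow> n = k - i \<or> n = k + i - 1 \<or> n = 2 * k"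
proof -
  define M where "M = 2 * int k + 1"
  have iff: "[int (Suc ((2 * k + 1) * N + n)) = r] (mod M) \<longleftrightarrow> [int (Suc n) = r] (mod M)" for r
  proof -
    have "int (Suc ((2 * k + 1) * N + n)) = int (Suc n) + int N * M"
      by (simp add: M_def algebra_simps)
    then show ?thesis by (simp add: cong_def del: of_nat_Suc)
  qed
  \<comment> \<open>The residues 0 and \<open>- (int k + 1 - int i)\<close> are replaced by
    representatives between 1 and \<open>M\<close>, where congruence to \<open>Suc n\<close> is
    equality.\<close>
  have r0: "[int (Suc n) = 0] (mod M) \<longleftrightarrow> [int (Suc n) = M] (mod M)"
    by (simp add: cong_def)
  have r2: "[int (Suc n) = - (int k + 1 - int i)] (mod M) \<longleftrightarrow> [int (Suc n) = int k + int i] (mod M)"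
  proof -
    have "int k + int i = - (int k + 1 - int i) + M" by (simp add: M_def)
    then show ?thesis unfolding cong_def by (metis mod_add_self2)
  qed
  have eq: "[int (Suc n) = r] (mod M) \<longleftrightarrow> int (Suc n) = r" if "1 \<le> r" "r \<le> M" for r
  proof
    assume "[int (Suc n) = r] (mod M)"
    then have "[int (Suc n) - 1 = r - 1] (mod M)" by (rule cong_diff) simp
    then have "int (Suc n) - 1 = r - 1"
      using that assms(3) by (intro cong_less_imp_eq_int[of _ M]) (auto simp: M_def)
    then show "int (Suc n) = r" by simp
  qed simp
  have "[int (Suc n) = M] (mod M) \<longleftrightarrow> n = 2 * k"
    by (subst eq) (auto simp: M_def)
  moreover have "[int (Suc n) = int k + 1 - int i] (mod M) \<longleftrightarrow> n = k - i"
    using assms(1,2) by (subst eq) (auto simp: M_def)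
  moreover have "[int (Suc n) = int k + int i] (mod M) \<longleftrightarrow> n = k + i - 1"
    using assms(1,2) by (subst eq) (auto simp: M_def)
  ultimately show ?thesis
    unfolding excluded_def M_def[symmetric] iff r0 r2 by blast
qed

text \<open>Multiplication by \<open>euler\<close> cancels every denominator and leaves just the
  excluded factors. Cut after \<open>N\<close> blocks of length \<open>2 * k + 1\<close>, they form
  the product in \<open>triple_product_cong\<close>.\<close>

lemma G_prod_mult_euler:
  assumes "1 \<le> i" "i \<le> k"
  shows "G_prod k i * euler = numer k 0 i (k - i + 1)"
proof (rule fps_cong_imp_eq)
  fix N
  let ?X = "fps_X :: complex fps"
  define Q where "Q = ?X ^ (2 * k + 1)"
  define g where "g m = (if excluded k i (Suc m) then 1 else 1 / (1 - ?X ^ Suc m))" for m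
  define h where "h m = (if excluded k i (Suc m) then 1 - ?X ^ Suc m else 1)" for m
  let ?L = "(2 * k + 1) * N"
  have unit: "1 / (1 - ?X ^ Suc m) * (1 - ?X ^ Suc m) = 1" for m
  proof -
    have "(1 - ?X ^ Suc m) $ 0 \<noteq> 0" by (simp del: power_Suc)
    then have "1 - ?X ^ Suc m dvd 1" by (simp add: fps_is_unit_iff del: power_Suc)
    then show ?thesis by simp
  qed
  have gh: "g m * (1 - ?X ^ Suc m) = h m" for m
    using unit[of m] by (simp add: g_def h_def del: power_Suc)
  have "fps_cong (Suc m) (g m) 1" for m
  proof (cases "excluded k i (Suc m)")
    case False
    have "fps_cong (Suc m) ((1 - ?X ^ Suc m) * g m) 1"
      using gh[of m] False by (simp add: h_def mult.commute del: power_Suc)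
    then show ?thesis by (rule fps_cong_1_right_factor[OF fps_cong_1_minus_X_power[OF order_refl]])
  qed (simp add: g_def)
  then have "fps_cong N (prodinf g) (\<Prod>m<?L. g m)"
    by (rule fps_cong_prodinf) simp
  moreover have "G_prod k i = prodinf g"
    unfolding G_prod_def g_def excluded_def Let_def ..
  ultimately have "fps_cong N (G_prod k i * euler) ((\<Prod>m<?L. g m) * (\<Prod>m<?L. 1 - ?X ^ Suc m))"
    by (intro fps_cong_mult euler_cong) simp_all
  also have "(\<Prod>m<?L. g m) * (\<Prod>m<?L. 1 - ?X ^ Suc m) = (\<Prod>m<?L. h m)"
    by (simp only: gh flip: prod.distrib)
  also have "\<dots> = (\<Prod>m<N. (1 - ?X ^ (k + i) * Q ^ m) * (1 - ?X ^ (k - i + 1) * Q ^ m) * (1 - Q ^ Suc m))"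
  proof (induction N)
    case (Suc N)
    define M where "M = (2 * k + 1) * N"
    have h: "h (M + n) = (if n = k - i \<or> n = k + i - 1 \<or> n = 2 * k then 1 - ?X ^ Suc (M + n) else 1)"
      if "n < 2 * k + 1" for n
      using excluded_block[OF assms that, of N] unfolding h_def M_def[symmetric] by (simp only:)
    have split: "(\<Prod>m<A + B. f m) = (\<Prod>m<A. f m) * (\<Prod>m<B. f (A + m))" for A B and f :: "nat \<Rightarrow> complex fps"
      by (induction B) (simp_all add: mult.assoc)
    have "(\<Prod>n<2 * k + 1. h (M + n)) = (\<Prod>n\<in>{k - i, k + i - 1, 2 * k}. h (M + n))"
      by (rule prod.mono_neutral_right) (use assms in \<open>auto simp: h\<close>)
    also have "\<dots> = (\<Prod>n\<in>{k - i, k + i - 1, 2 * k}. 1 - ?X ^ Suc (M + n))"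
      by (rule prod.cong[OF refl], subst h) (use assms in auto)
    \<comment> \<open>The indices are distinct, as \<open>k - i < k + i - 1 < 2 * k\<close>, so the
      set contributes three separate factors.\<close>
    also have "\<dots> = (1 - ?X ^ Suc (M + (k - i))) * ((1 - ?X ^ Suc (M + (k + i - 1))) * (1 - ?X ^ Suc (M + 2 * k)))"
      using assms by (subst prod.insert; (simp del: power_Suc)?)+ auto
    also have "Suc (M + (k - i)) = (k - i + 1) + M" by simp
    also have "Suc (M + (k + i - 1)) = (k + i) + M" using assms by simp
    also have "Suc (M + 2 * k) = (2 * k + 1) * Suc N" by (simp add: M_def)
    finally have "(\<Prod>n<2 * k + 1. h (M + n)) =
        (1 - ?X ^ (k + i) * Q ^ N) * (1 - ?X ^ (k - i + 1) * Q ^ N) * (1 - Q ^ Suc N)"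
      unfolding Q_def M_def power_mult[symmetric] power_add[symmetric] by (simp only: mult_ac)
    moreover have "(2 * k + 1) * Suc N = M + (2 * k + 1)" by (simp add: M_def)
    ultimately show ?case
      using Suc.IH unfolding M_def[symmetric] by (simp only: split prod.lessThan_Suc)
  qed simp
  also have "fps_cong N \<dots> (numer k 0 i (k - i + 1))"
    unfolding Q_def using assms by (intro triple_product_cong) simp_all
  finally show "fps_cong N (G_prod k i * euler) (numer k 0 i (k - i + 1))" .
qed

section \<open>Division by the Euler product and identification of \<open>G\<close> with
  \<open>H\<close>\<close>

text \<open>\<open>euler\<close> has constant coefficient 1, hence is a unit, and the division in
  \<open>H\<close> is exact.\<close>

lemma H_mult_euler: "H k j i * euler = numer k j i (k - i + 1)"
proof -
  have "euler dvd 1" using euler_nth_0 by (simp add: fps_is_unit_iff)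
  then show ?thesis
    unfolding H_eq_numer by (meson dvd_div_mult_self dvd_trans one_dvd)
qed

lemma H_0: "1 \<le> i \<Longrightarrow> i \<le> k \<Longrightarrow> H k 0 i = G_prod k i"
  using G_prod_mult_euler[of i k] H_mult_euler[of k 0 i] euler_nonzero
  by (metis mult_right_cancel)

text \<open>The case \<open>a = 1\<close>, \<open>c = k\<close> of \<open>numer_rec\<close>: the
  power of the variable is 1 and the subtracted numerator has last argument 0, so it
  vanishes.\<close>

lemma H_1:
  assumes "1 \<le> k"
  shows "H k (Suc j) 1 = H k j k"
proof -
  have "H k (Suc j) 1 * euler = H k j k * euler"
    using numer_rec[of 1 k k j] assms by (simp add: H_mult_euler numer_c_0)
  then show ?thesis using euler_nonzero by simp
qed

lemma H_rec:
  assumes "2 \<le> i" "i \<le> k"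
  shows "fps_X ^ ((i - 1) * Suc j) * H k (Suc j) i = H k j (k - i + 1) - H k j (k - i + 2)"
proof -
  have "k - (k - i + 1) + 1 = i" "k - (k - i + 2) + 1 = i - 1" using assms by auto
  then have "fps_X ^ ((i - 1) * Suc j) * H k (Suc j) i * euler = (H k j (k - i + 1) - H k j (k - i + 2)) * euler"
    using numer_rec[of i "k - i + 1" k j] assms
    by (simp add: H_mult_euler left_diff_distrib mult.assoc)
  then show ?thesis using euler_nonzero by simp
qed

text \<open>The induction keeps \<open>i\<close> arbitrary because the recursion passes from
  \<open>i\<close> to \<open>k - i + 1\<close> and \<open>k - i + 2\<close>. The recursion starts at
  \<open>i = 2\<close>; for \<open>i = 1\<close> the index equals \<open>(k - 1) * j + k\<close>,
  and \<open>H_1\<close> supplies the matching equality. By \<open>H_rec\<close> the divisor is a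
  factor of the numerator, so the quotient is a power series.\<close>

lemma G_eq_H:
  assumes "2 \<le> k" "1 \<le> i" "i \<le> k"
  shows "G k ((k - 1) * j + i) = fps_to_fls (H k j i)"
  using assms(2,3)
proof (induction j arbitrary: i)
  case 0
  then show ?case using assms(1) by (simp add: G_init H_0)
next
  case (Suc j)
  show ?case
  proof (cases "i = 1")
    case True
    have "(k - 1) * Suc j + 1 = (k - 1) * j + k" using assms(1) by simp
    then show ?thesis
      using Suc.IH[of k] assms(1) H_1[of k j] by (simp only: True)
  next
    case False
    with Suc.prems have i: "2 \<le> i" "i \<le> k" by auto
    have "(k - 1) * j + k - i + 1 = (k - 1) * j + (k - i + 1)"
      "(k - 1) * j + k - i + 2 = (k - 1) * j + (k - i + 2)" using i by auto
    then have "G k ((k - 1) * Suc j + i) =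
        (fps_to_fls (H k j (k - i + 1)) - fps_to_fls (H k j (k - i + 2))) / fls_X ^ ((i - 1) * Suc j)"
      using G_rec[of k "Suc j" i] assms(1) i Suc.IH[of "k - i + 1"] Suc.IH[of "k - i + 2"] by simp
    also have "\<dots> = fps_to_fls (fps_X ^ ((i - 1) * Suc j) * H k (Suc j) i) / fls_X ^ ((i - 1) * Suc j)"
      unfolding H_rec[OF i] by (simp only: fps_to_fls_minus)
    also have "\<dots> = fps_to_fls (H k (Suc j) i)"
      by (simp only: fls_times_fps_to_fls fps_to_fls_power fps_X_to_fls)
        (rule nonzero_mult_div_cancel_left, simp)
    finally show ?thesis .
  qed
qed

theorem theorem2p1:
  fixes k :: nat
  assumes "2 \<le> k"
  shows "(\<forall>j. \<forall>i\<in>{1..k}.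
            G k ((k - 1) * j + i) \<in> range fps_to_fls \<and>
            G k ((k - 1) * j + i) = fps_to_fls (H k j i)) \<and>
         (\<forall>j\<ge>1. H k j 1 = H k (j - 1) k)"
proof (intro conjI allI ballI impI)
  fix j i assume "i \<in> {1..k}"
  then show "G k ((k - 1) * j + i) = fps_to_fls (H k j i)"
    using assms by (intro G_eq_H) auto
  then show "G k ((k - 1) * j + i) \<in> range fps_to_fls" by simp
next
  fix j :: nat assume "1 \<le> j"
  then show "H k j 1 = H k (j - 1) k"
    using H_1[of k "j - 1"] assms by simp
qed

end
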